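(* Let $U$ be a non-empty finite set and let $R\subseteq U\times U$ be a binary relation on $U$. If $R$ is symmetric and serial (or symmetric and inverse serial), then for all $X\subseteq U$, $\underline{apr}_{p\wedge s}(X)\subseteq\overline{apr}_{p\wedge s}(X)$.
   Context: $R$ is symmetric if $(x,y)\in R$ implies $(y,x)\in R$; serial if for each $x\in U$ there is $y\in U$ with $(x,y)\in R$; inverse serial if for each $x\in U$ there is $y\in U$ with $(y,x)\in R$. For $x\in U$ put $R_{p\wedge s}(x)=\{y\in U\mid (x,y)\in R\text{ and }(y,x)\in R\}$. For $X\subseteq U$, $\underline{apr}_{p\wedge s}(X)=\{x\in U\mid R_{p\wedge s}(x)\subseteq X\}$ and $\overline{apr}_{p\wedge s}(X)=\{x\in U\mid R_{p\wedge s}(x)\cap X\neq\emptyset\}$. *)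

theory Defs
  imports Main
begin

definition serial_on :: "'a set \<Rightarrow> ('a \<times> 'a) set \<Rightarrow> bool" where
  "serial_on U R \<longleftrightarrow> (\<forall>x\<in>U. \<exists>y\<in>U. (x, y) \<in> R)"

definition inverse_serial_on :: "'a set \<Rightarrow> ('a \<times> 'a) set \<Rightarrow> bool" where
  "inverse_serial_on U R \<longleftrightarrow> (\<forall>x\<in>U. \<exists>y\<in>U. (y, x) \<in> R)"

text \<open>The predecessor-and-successor neighbourhood of \<open>x\<close>.\<close>
definition nbhd_ps :: "'a set \<Rightarrow> ('a \<times> 'a) set \<Rightarrow> 'a \<Rightarrow> 'a set" where
  "nbhd_ps U R x = {y \<in> U. (x, y) \<in> R \<and> (y, x) \<in> R}"

definition lower_apr_ps :: "'a set \<Rightarrow> ('a \<times> 'a) set \<Rightarrow> 'a set \<Rightarrow> 'a set" where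
  "lower_apr_ps U R X = {x \<in> U. nbhd_ps U R x \<subseteq> X}"

definition upper_apr_ps :: "'a set \<Rightarrow> ('a \<times> 'a) set \<Rightarrow> 'a set \<Rightarrow> 'a set" where
  "upper_apr_ps U R X = {x \<in> U. nbhd_ps U R x \<inter> X \<noteq> {}}"

end

theory Submission
  imports Defs
begin

text \<open>The inclusion can fail only at a point with empty neighbourhood, which satisfies the
  lower condition vacuously. Symmetry turns a single successor or predecessor in \<open>U\<close>
  into a two-sided neighbour, so either form of seriality rules such points out.\<close>

theorem proposition27:
  fixes U :: "'a set" and R :: "('a \<times> 'a) set"
  assumes "finite U" and "U \<noteq> {}" and "R \<subseteq> U \<times> U"
    and "(sym R \<and> serial_on U R) \<or> (sym R \<and> inverse_serial_on U R)"
  shows "\<forall>X. X \<subseteq> U \<longrightarrow> lower_apr_ps U R X \<subseteq> upper_apr_ps U R X"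
proof -
  have "nbhd_ps U R x \<noteq> {}" if "x \<in> U" for x
    using assms(4) that
    unfolding serial_on_def inverse_serial_on_def nbhd_ps_def
    by (blast dest: symD)
  \<comment> \<open>A nonempty neighbourhood contained in \<open>X\<close> meets \<open>X\<close>:
    any of its elements is a witness.\<close>
  then show ?thesis
    unfolding lower_apr_ps_def upper_apr_ps_def by blast
qed

end
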